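(* As $t\to\infty$, $\;t^2\log t\ll|\mathcal{R}_2(t)|\ll t^2\log t$; that is, there are constants $c_1,c_2>0$ and $t_0\geq 1$ such that $c_1 t^2\log t\leq |\mathcal{R}_2(t)|\leq c_2 t^2\log t$ for all $t\geq t_0$.
   Context: For a polynomial $p(X)=a_nX^n+\cdots+a_1X+a_0\in\mathbb{Z}[X]$ its height is $H(p)=\max\{|a_i| : i=0,\dots,n\}$. For real $t\geq 1$, $\mathcal{R}_2(t)$ denotes the set of all polynomials $p(X)\in\mathbb{Z}[X]$ of degree exactly $2$ with $H(p)\leq t$ which are reducible in $\mathbb{Q}[X]$. *)

theory Defs
  imports Complex_Main "HOL-Computational_Algebra.Polynomial"
begin

definition height :: "int poly \<Rightarrow> int" where
  "height p = Max ((\<lambda>i. \<bar>coeff p i\<bar>) ` {..degree p})"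

text \<open>A polynomial of degree 2 is neither zero nor a unit of \<open>\<rat>[X]\<close>, so here reducible is the
  negation of irreducible. Reducibility is over \<open>\<rat>\<close>: a nontrivial content of \<open>p\<close>
  does not make it reducible.\<close>

definition R2 :: "real \<Rightarrow> int poly set" where
  "R2 t = {p. degree p = 2 \<and> of_int (height p) \<le> t \<and>
              \<not> irreducible (map_poly of_int p :: rat poly)}"

text \<open>Finiteness ensures that \<open>card (R2 t)\<close> is the actual number of elements.\<close>

lemma abs_coeff_le_height: "\<bar>coeff p i\<bar> \<le> height p"
proof (cases "i \<le> degree p")
  case True
  then show ?thesis unfolding height_def by (intro Max_ge) auto
next
  case False
  have "\<bar>coeff p 0\<bar> \<le> height p" unfolding height_def by (intro Max_ge) auto
  with False show ?thesis by (simp add: coeff_eq_0)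
qed

lemma finite_R2: "finite (R2 t)"
proof -
  let ?I = "{- \<lfloor>t\<rfloor>..\<lfloor>t\<rfloor>}"
  have "p \<in> (\<lambda>(a, b, c). [:c, b, a:]) ` (?I \<times> ?I \<times> ?I)" if "p \<in> R2 t" for p
  proof -
    have deg: "degree p = 2" and "height p \<le> \<lfloor>t\<rfloor>"
      using that by (auto simp: R2_def le_floor_iff)
    then have bnd: "coeff p i \<in> ?I" for i
      using abs_coeff_le_height[of p i] by auto
    have "p = [:coeff p 0, coeff p 1, coeff p 2:]"
      using deg by (intro poly_eqI)
        (auto simp: coeff_pCons numeral_2_eq_2 coeff_eq_0 split: nat.split)
    with bnd show ?thesis
      by (intro image_eqI[of _ _ "(coeff p 2, coeff p 1, coeff p 0)"]) auto
  qed
  then have "R2 t \<subseteq> (\<lambda>(a, b, c). [:c, b, a:]) ` (?I \<times> ?I \<times> ?I)" by blast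
  then show ?thesis by (rule finite_subset) auto
qed

end

theory Submission
  imports Defs "HOL-Analysis.Gamma_Function" "HOL-Number_Theory.Totient"
begin

text \<open>A reducible quadratic has a rational root, so by Gauss's lemma it is a product of two linear
  polynomials over \<open>\<int>\<close>, and the product of their heights is at most twice its own height. There
  are at most \<open>8 m\<close> factors of height \<open>m\<close>, each admitting \<open>O((t/m)\<^sup>2)\<close> cofactors; summing
  \<open>t\<^sup>2/m\<close> over \<open>m \<le> 2 t\<close> gives the upper bound. For the lower bound one multiplies
  \<open>u X + v\<close> and \<open>g X + k\<close>, where \<open>v \<le> u\<close> are coprime and \<open>g \<le> l < k \<le> 2 l\<close> for
  \<open>l = \<lfloor>n/u\<rfloor>\<close>, \<open>n = \<lfloor>t/4\<rfloor>\<close>. These products are distinct because the roots satisfy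
  \<open>-k/g < -1 \<le> -v/u\<close>. Their number \<open>\<Sum>u\<le>n. \<phi>(u) \<lfloor>n/u\<rfloor>\<^sup>2\<close> is of order \<open>n\<^sup>2 \<Sum>u\<le>n. \<phi>(u)/u\<^sup>2\<close>,
  and the last sum is comparable to the harmonic sum.\<close>

lemma harm_le_one_plus_ln:
  assumes "0 < n"
  shows "harm n \<le> 1 + ln (real n)"
  using euler_mascheroni_sequence_decreasing[of 1 n] assms by (simp add: harm_expand)

lemma sum_inverse_squares_le: "(\<Sum>k=1..n. 1 / (real k)\<^sup>2) \<le> pi\<^sup>2 / 6"
proof -
  have "(\<Sum>k=1..n. 1 / (real k)\<^sup>2) = (\<Sum>k<n. 1 / (real k + 1)\<^sup>2)"
    by (simp add: sum.atLeast1_atMost_eq add.commute)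
  also have "\<dots> \<le> (\<Sum>k. 1 / (real k + 1)\<^sup>2)"
    using inverse_squares_sums by (intro sum_le_suminf) (auto simp: sums_iff add.commute)
  also have "\<dots> = pi\<^sup>2 / 6"
    using inverse_squares_sums by (simp add: sums_iff add.commute)
  finally show ?thesis .
qed

lemma sum_divisor_convolution_le:
  fixes f g :: "nat \<Rightarrow> 'a::linordered_semidom"
  assumes f: "\<And>n. 0 \<le> f n" and g: "\<And>n. 0 \<le> g n"
  shows "(\<Sum>k=1..n. \<Sum>d | d dvd k. f d * g (k div d)) \<le> (\<Sum>d=1..n. f d) * (\<Sum>e=1..n. g e)"
proof -
  let ?P = "{(d, e). 1 \<le> d \<and> 1 \<le> e \<and> d * e \<le> n}"
  have P: "?P \<subseteq> {1..n} \<times> {1..n}"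
  proof clarify
    fix d e :: nat
    assume pos: "1 \<le> d" "1 \<le> e" and "d * e \<le> n"
    have "d \<le> d * e" "e \<le> d * e"
      using pos by simp_all
    from this[THEN order_trans, OF \<open>d * e \<le> n\<close>] show "d \<in> {1..n} \<and> e \<in> {1..n}"
      using pos by simp
  qed
  have "(\<Sum>k=1..n. \<Sum>d | d dvd k. f d * g (k div d)) =
      (\<Sum>(k, d)\<in>(SIGMA k:{1..n}. {d. d dvd k}). f d * g (k div d))"
    by (rule sum.Sigma) auto
  also have "\<dots> = (\<Sum>(d, e)\<in>?P. f d * g e)"
    by (rule sum.reindex_bij_witness[of _ "\<lambda>(d, e). (d * e, d)" "\<lambda>(k, d). (d, k div d)"])
      (auto elim!: dvdE)
  also have "\<dots> \<le> (\<Sum>(d, e)\<in>{1..n} \<times> {1..n}. f d * g e)"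
    using P f g by (intro sum_mono2) auto
  also have "\<dots> = (\<Sum>d=1..n. f d) * (\<Sum>e=1..n. g e)"
    by (simp add: sum_product sum.cartesian_product)
  finally show ?thesis .
qed

text \<open>Expand \<open>1/u = (\<Sum>d dvd u. \<phi> d) / u\<^sup>2\<close> and write \<open>u = d e\<close>.\<close>

lemma harm_le_sum_totient_over_square:
  "harm n \<le> pi\<^sup>2 / 6 * (\<Sum>u=1..n. real (totient u) / (real u)\<^sup>2)"
proof -
  have divisor_sum: "inverse (real u) =
      (\<Sum>d | d dvd u. real (totient d) / (real d)\<^sup>2 * (1 / (real (u div d))\<^sup>2))"
    if "u \<in> {1..n}" for u
  proof -
    have "inverse (real u) = real (\<Sum>d | d dvd u. totient d) / (real u)\<^sup>2"
      by (simp add: totient_divisor_sum power2_eq_square field_simps)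
    also have "\<dots> = (\<Sum>d | d dvd u. real (totient d) / (real u)\<^sup>2)"
      by (simp add: sum_divide_distrib)
    also have "\<dots> = (\<Sum>d | d dvd u. real (totient d) / (real d)\<^sup>2 * (1 / (real (u div d))\<^sup>2))"
      using that by (intro sum.cong) (auto simp: real_of_nat_div power_divide)
    finally show ?thesis .
  qed
  have "harm n =
      (\<Sum>u=1..n. \<Sum>d | d dvd u. real (totient d) / (real d)\<^sup>2 * (1 / (real (u div d))\<^sup>2))"
    unfolding harm_def by (rule sum.cong[OF refl divisor_sum])
  also have "\<dots> \<le> (\<Sum>d=1..n. real (totient d) / (real d)\<^sup>2) * (\<Sum>e=1..n. 1 / (real e)\<^sup>2)"
    by (rule sum_divisor_convolution_le) simp_all
  also have "\<dots> \<le> (\<Sum>d=1..n. real (totient d) / (real d)\<^sup>2) * (pi\<^sup>2 / 6)"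
    by (intro mult_left_mono sum_inverse_squares_le sum_nonneg) simp
  finally show ?thesis
    by (simp add: mult.commute)
qed

lemma map_poly_of_int_add:
  "map_poly of_int (p + q) = (map_poly of_int p + map_poly of_int q :: 'a::ring_1 poly)"
  by (rule poly_eqI) (simp add: coeff_map_poly)

lemma map_poly_of_int_mult:
  "map_poly of_int (p * q) = (map_poly of_int p * map_poly of_int q :: 'a::comm_ring_1 poly)"
  by (rule poly_eqI) (simp add: coeff_map_poly coeff_mult)

lemma degree_map_poly_of_int:
  "degree (map_poly of_int p :: 'a::ring_char_0 poly) = degree p"
  by (rule degree_map_poly) simp

lemma primitive_dvd_if_map_poly_of_int_dvd:
  fixes f p :: "int poly"
  assumes primitive: "Polynomial.content f = 1"
    and dvd: "map_poly of_int f dvd (map_poly of_int p :: 'a::field_char_0 poly)"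
  shows "f dvd p"
proof -
  let ?hom = "map_poly of_int :: int poly \<Rightarrow> 'a poly"
  have "f \<noteq> 0"
    using primitive by auto
  then obtain a q r where "a \<noteq> 0" and division: "smult a p = f * q + r"
    and r: "r = 0 \<or> degree r < degree f"
    using pseudo_mod by metis
  have "?hom f dvd ?hom ([:a:] * p)"
    using dvd by (simp only: map_poly_of_int_mult dvd_mult)
  moreover have "?hom ([:a:] * p) = ?hom f * ?hom q + ?hom r"
    by (simp add: division map_poly_of_int_add map_poly_of_int_mult)
  ultimately have "?hom f dvd ?hom r"
    by (simp add: dvd_add_right_iff)
  then have "?hom r = 0 \<or> degree f \<le> degree r"
    by (metis dvd_imp_degree_le degree_map_poly_of_int)
  then have "r = 0"
    using r by (auto simp: map_poly_eq_0_iff)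
  then have product: "smult a p = f * q"
    using division by simp
  then have "Polynomial.content q = Polynomial.content (smult a p)"
    using primitive by (simp add: content_mult)
  then have "[:a:] dvd q"
    by (simp add: const_poly_dvd_iff_dvd_content)
  then obtain s where "q = [:a:] * s" ..
  then have "[:a:] * p = [:a:] * (f * s)"
    using product by simp
  then have "p = f * s"
    using \<open>a \<noteq> 0\<close> by (subst (asm) mult_cancel_left) simp
  then show ?thesis ..
qed

lemma rational_root_imp_linear_dvd:
  fixes p :: "int poly"
  assumes root: "poly (map_poly of_int p) x = 0" and x: "quotient_of x = (w, u)"
  shows "[:- w, u:] dvd p"
proof (rule primitive_dvd_if_map_poly_of_int_dvd)
  have "u > 0" "coprime w u" "x = of_int w / of_int u"
    using quotient_of_denom_pos[OF x] quotient_of_coprime[OF x] quotient_of_div[OF x] by auto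
  then show "Polynomial.content [:- w, u:] = 1"
    by (simp add: Polynomial.content_def)
  have "map_poly rat_of_int [:- w, u:] = smult (of_int u) [:- x, 1:]"
    using \<open>u > 0\<close> \<open>x = _\<close> by (simp add: map_poly_pCons)
  then show "map_poly rat_of_int [:- w, u:] dvd map_poly of_int p"
    using root \<open>u > 0\<close> by (simp only: poly_eq_0_iff_dvd smult_dvd of_int_eq_0_iff)
qed

lemma degree_le_1E:
  assumes "degree p \<le> 1"
  obtains a b where "p = [:a, b:]"
  using assms by (cases p) (auto simp: degree_pCons_eq_if split: if_splits elim!: degree_eq_zeroE)

lemma degree_1_imp_root:
  fixes p :: "'a::field poly"
  assumes "degree p = 1"
  obtains x where "poly p x = 0"
proof -
  obtain c d where p: "p = [:c, d:]"
    using assms degree_le_1E[of p] by auto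
  then have "d \<noteq> 0"
    using assms by auto
  then have "poly p (- c / d) = 0"
    by (simp add: p)
  then show ?thesis ..
qed

lemma reducible_degree_le_3_imp_root:
  fixes p :: "'a::field poly"
  assumes "0 < degree p" "degree p \<le> 3" "\<not> irreducible p"
  obtains x where "poly p x = 0"
proof -
  have "p \<noteq> 0"
    using assms(1) by auto
  moreover from this have "\<not> is_unit p"
    using assms(1) by (simp add: is_unit_iff_degree)
  ultimately obtain a b where p: "p = a * b" and "\<not> is_unit a" "\<not> is_unit b"
    using assms(3) unfolding irreducible_def by blast
  then have "degree a + degree b \<le> 3" "degree a \<noteq> 0" "degree b \<noteq> 0"
    using \<open>p \<noteq> 0\<close> assms(2) by (auto simp: degree_mult_eq is_unit_iff_degree)
  then have "degree a = 1 \<or> degree b = 1"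
    by linarith
  then obtain x where "poly a x = 0 \<or> poly b x = 0"
    using degree_1_imp_root by metis
  then have "poly p x = 0"
    by (auto simp: p)
  then show ?thesis ..
qed

lemma quadratic_reducible_over_rat_imp_linear_factors:
  fixes p :: "int poly"
  assumes deg: "degree p = 2" and reducible: "\<not> irreducible (map_poly of_int p :: rat poly)"
  obtains q r where "degree q = 1" "degree r = 1" "p = q * r"
proof -
  obtain x :: rat where root: "poly (map_poly of_int p) x = 0"
    using reducible_degree_le_3_imp_root[OF _ _ reducible] deg
    by (auto simp: degree_map_poly_of_int)
  obtain w u where x: "quotient_of x = (w, u)"
    by fastforce
  then have "u \<noteq> 0"
    using quotient_of_denom_pos by fastforce
  obtain r where p: "p = [:- w, u:] * r"
    using rational_root_imp_linear_dvd[OF root x] by (rule dvdE)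
  then have "r \<noteq> 0"
    using deg by auto
  then have "degree r = 1"
    using deg \<open>u \<noteq> 0\<close> unfolding p by (subst (asm) degree_mult_eq) auto
  then show ?thesis
    using that[of "[:- w, u:]" r] \<open>u \<noteq> 0\<close> p by simp
qed

lemma linear_factors_imp_reducible_over_rat:
  fixes q r :: "int poly"
  assumes "degree q = 1" "degree r = 1"
  shows "\<not> irreducible (map_poly of_int (q * r) :: rat poly)"
proof -
  have "\<not> is_unit (map_poly of_int q :: rat poly)" "\<not> is_unit (map_poly of_int r :: rat poly)"
    using assms by (auto simp: degree_map_poly_of_int dest!: dvd_imp_degree_le)
  then show ?thesis
    using irreducibleD[OF _ map_poly_of_int_mult] by blast
qed

lemma mem_R2_iff:
  "p \<in> R2 t \<longleftrightarrow>
    (\<exists>q r. degree q = 1 \<and> degree r = 1 \<and> p = q * r) \<and> height p \<le> \<lfloor>t\<rfloor>"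
proof -
  have "degree (q * r) = 2" if "degree q = 1" "degree r = 1" for q r :: "int poly"
    using that by (subst degree_mult_eq) auto
  then have "degree p = 2 \<and> \<not> irreducible (map_poly of_int p :: rat poly) \<longleftrightarrow>
      (\<exists>q r. degree q = 1 \<and> degree r = 1 \<and> p = q * r)"
    using linear_factors_imp_reducible_over_rat quadratic_reducible_over_rat_imp_linear_factors
    by metis
  then show ?thesis
    unfolding R2_def le_floor_iff by blast
qed

lemma height_le_iff: "height p \<le> h \<longleftrightarrow> (\<forall>i. \<bar>coeff p i\<bar> \<le> h)"
proof
  show "\<forall>i. \<bar>coeff p i\<bar> \<le> h" if "height p \<le> h"
    using that abs_coeff_le_height order_trans by blast
qed (simp add: height_def)

lemma height_nonneg: "0 \<le> height p"
  using abs_coeff_le_height[of p 0] by simp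

lemma height_0 [simp]: "height 0 = 0"
  by (simp add: height_def)

lemma height_pos:
  assumes "p \<noteq> 0"
  shows "0 < height p"
proof -
  have "0 < \<bar>coeff p (degree p)\<bar>"
    using assms by simp
  also have "\<dots> \<le> height p"
    by (rule abs_coeff_le_height)
  finally show ?thesis .
qed

lemma height_pCons: "height (pCons a p) = max \<bar>a\<bar> (height p)"
proof -
  have "height (pCons a p) \<le> h \<longleftrightarrow> max \<bar>a\<bar> (height p) \<le> h" for h
    by (auto simp: height_le_iff coeff_pCons split: nat.split)
  then show ?thesis
    by (meson order.antisym order.refl)
qed

lemma height_mult_le: "height (p * q) \<le> (int (degree p) + 1) * (height p * height q)"
  unfolding height_le_iff
proof
  fix n
  have "\<bar>coeff p i * coeff q (n - i)\<bar> \<le> (if i \<le> degree p then height p * height q else 0)" for i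
    by (auto simp: abs_mult coeff_eq_0 height_nonneg intro!: mult_mono abs_coeff_le_height)
  then have "\<bar>coeff (p * q) n\<bar> \<le> (\<Sum>i\<le>n. if i \<le> degree p then height p * height q else 0)"
    unfolding coeff_mult by (intro order_trans[OF sum_abs] sum_mono)
  also have "\<dots> = int (card ({..n} \<inter> {..degree p})) * (height p * height q)"
    by (simp add: sum.If_cases atMost_def)
  also have "\<dots> \<le> (int (degree p) + 1) * (height p * height q)"
  proof (rule mult_right_mono)
    have "card ({..n} \<inter> {..degree p}) \<le> card {..degree p}"
      by (rule card_mono) auto
    then show "int (card ({..n} \<inter> {..degree p})) \<le> int (degree p) + 1"
      by simp
  qed (simp add: height_nonneg)
  finally show "\<bar>coeff (p * q) n\<bar> \<le> (int (degree p) + 1) * (height p * height q)" .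
qed

lemma abs_le_if_abs_mult_le_abs_add_le:
  fixes x y b :: "'a::linordered_idom"
  assumes "\<bar>x * y\<bar> \<le> b\<^sup>2" "\<bar>x + y\<bar> \<le> b"
  shows "\<bar>x\<bar> \<le> 2 * b"
proof (rule ccontr)
  assume "\<not> ?thesis"
  then have "\<bar>x\<bar> > b" "\<bar>y\<bar> > b" "b \<ge> 0"
    using assms(2) by linarith+
  then have "\<bar>x\<bar> * \<bar>y\<bar> > b * b"
    by (intro mult_strict_mono) auto
  then show False
    using assms(1) by (simp add: abs_mult power2_eq_square)
qed

text \<open>The two cross terms \<open>u k\<close> and \<open>v g\<close> sum to the middle coefficient, and their product is the
  product of the outer coefficients.\<close>

lemma linear_height_times_height_le:
  assumes "degree p \<le> 1" "degree q \<le> 1"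
  shows "height p * height q \<le> 2 * height (p * q)"
proof -
  obtain v u k g where p: "p = [:v, u:]" and q: "q = [:k, g:]"
    using assms by (metis degree_le_1E)
  define h where "h = height (p * q)"
  have "p * q = [:v * k, u * k + v * g, u * g:]"
    by (simp add: p q algebra_simps)
  then have bounds: "\<bar>v * k\<bar> \<le> h" "\<bar>u * k + v * g\<bar> \<le> h" "\<bar>u * g\<bar> \<le> h"
    by (simp_all add: h_def height_pCons)
  have "\<bar>(v * k) * (u * g)\<bar> \<le> h\<^sup>2"
    unfolding abs_mult[of "v * k"] power2_eq_square using bounds by (intro mult_mono) auto
  then have "\<bar>(u * k) * (v * g)\<bar> \<le> h\<^sup>2" "\<bar>(v * g) * (u * k)\<bar> \<le> h\<^sup>2"
    by (simp_all add: ac_simps)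
  then have "\<bar>u * k\<bar> \<le> 2 * h" "\<bar>v * g\<bar> \<le> 2 * h"
    using bounds(2) by (auto intro: abs_le_if_abs_mult_le_abs_add_le simp: add.commute)
  moreover have "\<bar>v * k\<bar> \<le> 2 * h" "\<bar>u * g\<bar> \<le> 2 * h"
    using bounds by linarith+
  ultimately have "max \<bar>v\<bar> \<bar>u\<bar> * max \<bar>k\<bar> \<bar>g\<bar> \<le> 2 * h"
    unfolding abs_mult by (simp add: max_def)
  moreover have "height p = max \<bar>v\<bar> \<bar>u\<bar>" "height q = max \<bar>k\<bar> \<bar>g\<bar>"
    by (simp_all add: p q height_pCons)
  ultimately show ?thesis
    by (simp only: h_def)
qed

definition bounded_height_polys :: "nat \<Rightarrow> nat \<Rightarrow> int poly set" where
  "bounded_height_polys d h = {p. degree p \<le> d \<and> height p \<le> int h}"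

lemma bounded_height_polys_0:
  "bounded_height_polys 0 h = (\<lambda>a. [:a:]) ` {- int h..int h}"
  by (auto simp: bounded_height_polys_def height_pCons abs_le_iff elim!: degree_eq_zeroE)

lemma bounded_height_polys_Suc:
  "bounded_height_polys (Suc d) h =
    (\<lambda>(a, p). pCons a p) ` ({- int h..int h} \<times> bounded_height_polys d h)" (is "_ = ?S")
proof (rule set_eqI)
  fix p :: "int poly"
  obtain a q where p: "p = pCons a q"
    by (cases p)
  have "p \<in> bounded_height_polys (Suc d) h \<longleftrightarrow>
      a \<in> {- int h..int h} \<and> q \<in> bounded_height_polys d h"
    by (auto simp: p bounded_height_polys_def height_pCons degree_pCons_eq_if)
  then show "p \<in> bounded_height_polys (Suc d) h \<longleftrightarrow> p \<in> ?S"
    by (auto simp: p)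
qed

lemma card_bounded_height_polys: "card (bounded_height_polys d h) = (2 * h + 1) ^ Suc d"
proof (induction d)
  case 0
  have "inj (\<lambda>a::int. [:a:])"
    by (rule injI) simp
  then show ?case
    by (simp add: bounded_height_polys_0 card_image inj_on_subset nat_add_distrib)
next
  case (Suc d)
  have "inj_on (\<lambda>(a, p). pCons a p) ({- int h..int h} \<times> bounded_height_polys d h)"
    by (auto simp: inj_on_def)
  then show ?case
    by (simp add: bounded_height_polys_Suc card_image card_cartesian_product Suc.IH
        nat_add_distrib)
qed

lemma finite_bounded_height_polys [simp]: "finite (bounded_height_polys d h)"
  by (rule card_ge_0_finite) (simp add: card_bounded_height_polys)

definition polys_of_height :: "nat \<Rightarrow> nat \<Rightarrow> int poly set" where
  "polys_of_height d h = {p. degree p \<le> d \<and> height p = int h}"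

lemma finite_polys_of_height [simp]: "finite (polys_of_height d h)"
proof (rule finite_subset)
  show "polys_of_height d h \<subseteq> bounded_height_polys d h"
    by (auto simp: polys_of_height_def bounded_height_polys_def)
qed (rule finite_bounded_height_polys)

lemma card_polys_of_height:
  assumes "0 < h"
  shows "card (polys_of_height d h) = (2 * h + 1) ^ Suc d - (2 * h - 1) ^ Suc d"
proof -
  have "polys_of_height d h = bounded_height_polys d h - bounded_height_polys d (h - 1)"
    using assms by (auto simp: polys_of_height_def bounded_height_polys_def)
  moreover have "bounded_height_polys d (h - 1) \<subseteq> bounded_height_polys d h"
    using assms by (auto simp: bounded_height_polys_def)
  moreover have "2 * (h - 1) + 1 = 2 * h - 1"
    using assms by simp
  ultimately show ?thesis
    by (simp only: card_Diff_subset finite_bounded_height_polys card_bounded_height_polys)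
qed

lemma card_linear_polys_of_height:
  assumes "0 < h"
  shows "card (polys_of_height 1 h) = 8 * h"
proof -
  obtain k where "h = Suc k"
    using assms gr0_implies_Suc by blast
  then show ?thesis
    by (simp add: card_polys_of_height power2_eq_square algebra_simps)
qed

lemma R2_subset_products_of_bounded_height:
  assumes n: "2 * \<lfloor>t\<rfloor> \<le> int n"
  shows "R2 t \<subseteq> (\<Union>m\<in>{1..n}. (\<lambda>(q, r). q * r) `
    (polys_of_height 1 m \<times> bounded_height_polys 1 (n div m)))" (is "_ \<subseteq> ?S")
proof
  fix p assume "p \<in> R2 t"
  then obtain q r where deg: "degree q = 1" "degree r = 1" and p: "p = q * r"
    and height: "height p \<le> \<lfloor>t\<rfloor>"
    unfolding mem_R2_iff by blast
  define m l where "m = nat (height q)" and "l = nat (height r)"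
  have heights: "height q = int m" "height r = int l"
    by (simp_all add: m_def l_def height_nonneg)
  have "q \<noteq> 0" "r \<noteq> 0"
    using deg by auto
  then have "0 < m" "0 < l"
    by (simp_all add: m_def l_def height_pos)
  have "int (m * l) \<le> 2 * height p"
    using deg linear_height_times_height_le[of q r] by (simp add: p heights)
  then have "m * l \<le> n"
    using height n by linarith
  then have "l \<le> n div m"
    using \<open>0 < m\<close> by (simp add: less_eq_div_iff_mult_less_eq mult.commute)
  then have "(q, r) \<in> polys_of_height 1 m \<times> bounded_height_polys 1 (n div m)"
    using deg by (simp add: polys_of_height_def bounded_height_polys_def heights)
  moreover have "m \<le> m * l"
    using \<open>0 < l\<close> by simp
  then have "m \<le> n"
    using \<open>m * l \<le> n\<close> by (rule order_trans)
  then have "m \<in> {1..n}"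
    using \<open>0 < m\<close> by simp
  ultimately show "p \<in> ?S"
    unfolding p by (intro UN_I image_eqI[of _ _ "(q, r)"]) simp_all
qed

lemma card_R2_le_sum:
  assumes "2 * \<lfloor>t\<rfloor> \<le> int n"
  shows "card (R2 t) \<le> (\<Sum>m=1..n. 8 * m * (2 * (n div m) + 1)\<^sup>2)"
proof -
  let ?A = "\<lambda>m. polys_of_height 1 m \<times> bounded_height_polys 1 (n div m)"
  let ?mult = "\<lambda>(q, r). q * r :: int poly"
  have "card (R2 t) \<le> card (\<Union>m\<in>{1..n}. ?mult ` ?A m)"
    using R2_subset_products_of_bounded_height[OF assms] by (intro card_mono) auto
  also have "\<dots> \<le> (\<Sum>m=1..n. card (?mult ` ?A m))"
    by (rule card_UN_le) simp
  also have "\<dots> \<le> (\<Sum>m=1..n. card (?A m))"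
    by (intro sum_mono card_image_le) simp
  also have "\<dots> = (\<Sum>m=1..n. 8 * m * (2 * (n div m) + 1)\<^sup>2)"
  proof (rule sum.cong)
    fix m assume "m \<in> {1..n}"
    then have "card (polys_of_height 1 m) = 8 * m"
      by (intro card_linear_polys_of_height) simp
    then show "card (?A m) = 8 * m * (2 * (n div m) + 1)\<^sup>2"
      by (simp only: card_cartesian_product card_bounded_height_polys Suc_1 flip: One_nat_def)
  qed simp
  finally show ?thesis .
qed

lemma card_R2_le_harm:
  assumes "2 * \<lfloor>t\<rfloor> \<le> int n"
  shows "real (card (R2 t)) \<le> 72 * (real n)\<^sup>2 * harm n"
proof -
  have "real (card (R2 t)) \<le> (\<Sum>m=1..n. real (8 * m * (2 * (n div m) + 1)\<^sup>2))"
    unfolding of_nat_sum[symmetric] of_nat_le_iff by (rule card_R2_le_sum[OF assms])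
  also have "\<dots> \<le> (\<Sum>m=1..n. 72 * (real n)\<^sup>2 * inverse (real m))"
  proof (rule sum_mono)
    fix m assume m: "m \<in> {1..n}"
    then have "1 \<le> n div m"
      by (simp add: div_greater_zero_iff Suc_le_eq)
    then have "real (2 * (n div m) + 1) \<le> real (3 * (n div m))"
      by (simp only: of_nat_le_iff)
    also have "\<dots> \<le> 3 * (real n / real m)"
      using of_nat_div_le_of_nat[of n m, where 'a = real] by simp
    finally have "(real (2 * (n div m) + 1))\<^sup>2 \<le> (3 * (real n / real m))\<^sup>2"
      by (rule power_mono) simp
    then have "8 * real m * (real (2 * (n div m) + 1))\<^sup>2 \<le> 8 * real m * (3 * (real n / real m))\<^sup>2"
      by (rule mult_left_mono) simp
    also have "\<dots> = 72 * (real n)\<^sup>2 * inverse (real m)"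
      using m by (simp add: field_simps power2_eq_square)
    finally show "real (8 * m * (2 * (n div m) + 1)\<^sup>2) \<le> 72 * (real n)\<^sup>2 * inverse (real m)"
      by (simp only: of_nat_mult of_nat_power of_nat_numeral)
  qed
  also have "\<dots> = 72 * (real n)\<^sup>2 * harm n"
    by (simp add: harm_def sum_distrib_left)
  finally show ?thesis .
qed

lemma separated_linear_product_unique:
  fixes u v g k u' v' g' k' :: nat
  assumes "coprime v u" "0 < v" "v \<le> u" "0 < g" "g < k"
    and "coprime v' u'" "0 < v'" "v' \<le> u'" "0 < g'" "g' < k'"
    and eq: "[:int v, int u:] * [:int k, int g:] = [:int v', int u':] * [:int k', int g':]"
  shows "u = u' \<and> v = v' \<and> g = g' \<and> k = k'"
proof -
  have coeffs: "int v * int k = int v' * int k'" "int u * int g = int u' * int g'"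
    "int u * int k + int v * int g = int u' * int k' + int v' * int g'"
    using eq by (auto simp: algebra_simps)
  have "(int v' * int u - int u' * int v) * (int k' * int u - int g' * int v) = 0"
    using coeffs by algebra
  moreover have "int g' * int v < int k' * int u"
    using assms by (intro mult_less_le_imp_less) auto
  ultimately have "int v' * int u = int u' * int v"
    by simp
  then have "v' * u = u' * v"
    by (metis of_nat_eq_iff of_nat_mult)
  then have "u = u' \<and> v = v'"
    using assms(1,6) by (metis coprime_crossproduct_nat coprime_commute mult.commute)
  moreover from this have "g = g'" "k = k'"
    using coeffs assms by auto
  ultimately show ?thesis
    by simp
qed

definition separated_factors :: "nat \<Rightarrow> (nat \<times> nat \<times> nat \<times> nat) set" where
  "separated_factors n =
    (SIGMA u:{1..n}. totatives u \<times> {1..n div u} \<times> {n div u<..2 * (n div u)})"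

definition linear_product :: "nat \<times> nat \<times> nat \<times> nat \<Rightarrow> int poly" where
  "linear_product = (\<lambda>(u, v, g, k). [:int v, int u:] * [:int k, int g:])"

lemma card_separated_factors:
  "card (separated_factors n) = (\<Sum>u=1..n. totient u * (n div u)\<^sup>2)"
  unfolding separated_factors_def
  by (subst card_SigmaI) (auto simp: card_cartesian_product totient_def power2_eq_square)

lemma inj_on_linear_product: "inj_on linear_product (separated_factors n)"
proof (rule inj_onI)
  fix x y
  assume mem: "x \<in> separated_factors n" "y \<in> separated_factors n"
    and eq: "linear_product x = linear_product y"
  obtain u v g k u' v' g' k' where xy: "x = (u, v, g, k)" "y = (u', v', g', k')"
    by (metis surj_pair)
  have "u = u' \<and> v = v' \<and> g = g' \<and> k = k'"
  proof (rule separated_linear_product_unique)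
    show "[:int v, int u:] * [:int k, int g:] = [:int v', int u':] * [:int k', int g':]"
      using eq by (simp only: xy linear_product_def prod.case)
  qed (use mem in \<open>auto simp: xy separated_factors_def in_totatives_iff\<close>)
  then show "x = y"
    by (simp add: xy)
qed

lemma linear_product_mem_R2:
  assumes n: "4 * real n \<le> t" and mem: "x \<in> separated_factors n"
  shows "linear_product x \<in> R2 t"
proof -
  obtain u v g k where x: "x = (u, v, g, k)"
    by (metis surj_pair)
  let ?q = "[:int v, int u:]" and ?r = "[:int k, int g:]"
  have bounds: "0 < u" "v \<le> u" "0 < g" "g \<le> n div u" "k \<le> 2 * (n div u)"
    using mem by (auto simp: x separated_factors_def in_totatives_iff)
  then have deg: "degree ?q = 1" "degree ?r = 1"
    by auto
  have "height (?q * ?r) \<le> 2 * (height ?q * height ?r)"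
    using height_mult_le[of ?q ?r] deg by simp
  also have "\<dots> \<le> 2 * (int u * int (2 * (n div u)))"
    using bounds by (intro mult_left_mono mult_mono) (auto simp: height_pCons)
  also have "\<dots> = int (4 * (u * (n div u)))"
    by simp
  also have "\<dots> \<le> int (4 * n)"
    by (simp only: of_nat_le_iff mult_le_mono2 times_div_less_eq_dividend)
  also have "\<dots> \<le> \<lfloor>t\<rfloor>"
    using n by (simp add: le_floor_iff)
  finally show ?thesis
    unfolding mem_R2_iff linear_product_def x prod.case using deg by blast
qed

lemma half_quotient_le_div:
  assumes "0 < u" "u \<le> n"
  shows "real n / (2 * real u) \<le> real (n div u)"
proof -
  have "1 \<le> n div u"
    using assms by (simp add: div_greater_zero_iff Suc_le_eq)
  then have "u \<le> u * (n div u)"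
    by simp
  then have "n \<le> 2 * u * (n div u)"
    using mult_div_mod_eq[of u n] mod_less_divisor[OF assms(1), of n] by linarith
  then have "real n \<le> real (2 * u * (n div u))"
    by (simp only: of_nat_le_iff)
  then show ?thesis
    using assms(1) by (simp add: field_simps)
qed

lemma harm_le_card_R2:
  assumes "4 * real n \<le> t"
  shows "3 / (2 * pi\<^sup>2) * (real n)\<^sup>2 * harm n \<le> real (card (R2 t))"
proof -
  have "card (separated_factors n) \<le> card (R2 t)"
    using inj_on_linear_product linear_product_mem_R2[OF assms] finite_R2
    by (intro card_inj_on_le[of linear_product]) auto
  then have card: "(\<Sum>u=1..n. real (totient u) * (real (n div u))\<^sup>2) \<le> real (card (R2 t))"
    unfolding card_separated_factors of_nat_le_iff[symmetric, where 'a = real] by simp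
  have "harm n * (6 / pi\<^sup>2) \<le> (\<Sum>u=1..n. real (totient u) / (real u)\<^sup>2)"
    using harm_le_sum_totient_over_square[of n] by (simp add: field_simps)
  then have "(real n)\<^sup>2 / 4 * (harm n * (6 / pi\<^sup>2)) \<le>
      (real n)\<^sup>2 / 4 * (\<Sum>u=1..n. real (totient u) / (real u)\<^sup>2)"
    by (rule mult_left_mono) simp
  also have "\<dots> = (\<Sum>u=1..n. real (totient u) * (real n / (2 * real u))\<^sup>2)"
    unfolding sum_distrib_left by (intro sum.cong) (auto simp: field_simps power2_eq_square)
  also have "\<dots> \<le> (\<Sum>u=1..n. real (totient u) * (real (n div u))\<^sup>2)"
    by (intro sum_mono mult_left_mono power_mono half_quotient_le_div) auto
  also note card
  finally show ?thesis
    by (simp add: field_simps)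
qed

lemma card_R2_ge:
  fixes t :: real
  assumes t: "16 \<le> t"
  shows "3 / (256 * pi\<^sup>2) * t\<^sup>2 * ln t \<le> real (card (R2 t))"
proof -
  define n where "n = nat \<lfloor>t / 4\<rfloor>"
  have n: "t / 4 \<le> real n + 1" "t / 8 \<le> real n" "4 * real n \<le> t"
    unfolding n_def using t by linarith+
  have "ln t \<le> ln ((t / 4)\<^sup>2)"
    using t by (intro ln_mono) (auto simp: power2_eq_square)
  also have "\<dots> = 2 * ln (t / 4)"
    using t by (simp add: ln_realpow)
  finally have "ln t / 2 \<le> ln (t / 4)"
    by simp
  also have "\<dots> \<le> ln (real n + 1)"
    using t n(1) by (intro ln_mono) auto
  also have "\<dots> \<le> harm n"
    by (rule ln_le_harm)
  finally have harm: "ln t / 2 \<le> harm n" .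
  have "3 / (256 * pi\<^sup>2) * t\<^sup>2 * ln t = 3 / (2 * pi\<^sup>2) * (t / 8)\<^sup>2 * (ln t / 2)"
    by (simp add: power_divide)
  also have "\<dots> \<le> 3 / (2 * pi\<^sup>2) * (real n)\<^sup>2 * harm n"
    using t n(2) harm by (intro mult_mono power_mono) auto
  also have "\<dots> \<le> real (card (R2 t))"
    by (rule harm_le_card_R2[OF n(3)])
  finally show ?thesis .
qed

lemma card_R2_le:
  fixes t :: real
  assumes t: "4 \<le> t"
  shows "real (card (R2 t)) \<le> 864 * t\<^sup>2 * ln t"
proof -
  define n where "n = nat (2 * \<lfloor>t\<rfloor>)"
  have n: "0 < n" "real n \<le> 2 * t" "2 * \<lfloor>t\<rfloor> \<le> int n"
    unfolding n_def using t by linarith+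
  have "2 * ln 2 = ln (2\<^sup>2 :: real)"
    by (subst ln_realpow) simp_all
  also have "\<dots> \<le> ln t"
    using t by simp
  finally have "1 + ln 2 \<le> 2 * ln t"
    using ln2_ge_two_thirds by linarith
  have "harm n \<le> 1 + ln (real n)"
    using n(1) by (rule harm_le_one_plus_ln)
  also have "\<dots> \<le> 1 + ln (2 * t)"
    using n by simp
  also have "\<dots> = 1 + ln 2 + ln t"
    using t by (simp add: ln_mult)
  also have "\<dots> \<le> 3 * ln t"
    using \<open>1 + ln 2 \<le> 2 * ln t\<close> by simp
  finally have harm: "harm n \<le> 3 * ln t" .
  have "real (card (R2 t)) \<le> 72 * (real n)\<^sup>2 * harm n"
    by (rule card_R2_le_harm[OF n(3)])
  also have "\<dots> \<le> 72 * (2 * t)\<^sup>2 * (3 * ln t)"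
    using n(2) harm by (intro mult_mono power_mono) (auto simp: harm_nonneg)
  also have "\<dots> = 864 * t\<^sup>2 * ln t"
    by (simp add: power_mult_distrib)
  finally show ?thesis .
qed

theorem theorem2:
  shows "\<exists>(c1::real)>0. \<exists>(c2::real)>0. \<exists>(t0::real)\<ge>1. \<forall>t\<ge>t0.
    c1 * t\<^sup>2 * ln t \<le> real (card (R2 t)) \<and> real (card (R2 t)) \<le> c2 * t\<^sup>2 * ln t"
proof (intro exI conjI allI impI)
  show "0 < 3 / (256 * pi\<^sup>2)" "(0::real) < 864" "(1::real) \<le> 16"
    by simp_all
next
  fix t :: real
  assume "16 \<le> t"
  then show "3 / (256 * pi\<^sup>2) * t\<^sup>2 * ln t \<le> real (card (R2 t))"
    and "real (card (R2 t)) \<le> 864 * t\<^sup>2 * ln t"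
    using card_R2_ge card_R2_le by simp_all
qed

end
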